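(* Let $A,B\in M_n(\mathbb{C})$ be positive definite and let $m,M$ be real numbers such that $0<mI\le A\le B\le MI$. If $v$ is a real number with $0\le v\le 1$, then $$A\nabla_v B-A!_v B\le v(1-v)\left(1-\frac{M}{m}\right)^2B.$$
   Context: $M_n(\mathbb{C})$ is the space of $n\times n$ complex matrices and $I$ is the identity matrix. For positive definite $A,B\in M_n(\mathbb{C})$ and $0\le v\le 1$, the weighted arithmetic and harmonic means are $A\nabla_v B=vA+(1-v)B$ and $A!_v B=\left(vA^{-1}+(1-v)B^{-1}\right)^{-1}$. The inequality $\le$ between Hermitian matrices is the Löwner order: $S\le T$ means that $T-S$ is positive semidefinite; $0<mI$ means that $mI$ is positive definite, i.e. $m>0$. *)

theory Defs
  imports "HOL-Analysis.Analysis"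
begin

definition hermitian :: "complex^'n^'n \<Rightarrow> bool" where
  "hermitian A \<longleftrightarrow> map_matrix cnj (transpose A) = A"

text \<open>The form \<open>x\<^sup>* A x\<close>, conjugate-linear in the first factor. It is real for Hermitian \<open>A\<close>, so that
  taking real parts below loses nothing.\<close>

definition quad_form :: "complex^'n^'n \<Rightarrow> complex^'n \<Rightarrow> complex" where
  "quad_form A x = (\<Sum>i\<in>UNIV. cnj (x $ i) * (A *v x) $ i)"

definition positive_semidefinite :: "complex^'n^'n \<Rightarrow> bool" where
  "positive_semidefinite A \<longleftrightarrow> hermitian A \<and> (\<forall>x. 0 \<le> Re (quad_form A x))"

definition positive_definite :: "complex^'n^'n \<Rightarrow> bool" where
  "positive_definite A \<longleftrightarrow> hermitian A \<and> (\<forall>x. x \<noteq> 0 \<longrightarrow> 0 < Re (quad_form A x))"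

definition loewner_le :: "complex^'n^'n \<Rightarrow> complex^'n^'n \<Rightarrow> bool"  (infix "\<le>\<^sub>L" 50) where
  "S \<le>\<^sub>L T \<longleftrightarrow> positive_semidefinite (T - S)"

definition arith_mean :: "real \<Rightarrow> complex^'n^'n \<Rightarrow> complex^'n^'n \<Rightarrow> complex^'n^'n" where
  "arith_mean v A B = v *\<^sub>R A + (1 - v) *\<^sub>R B"

definition harm_mean :: "real \<Rightarrow> complex^'n^'n \<Rightarrow> complex^'n^'n \<Rightarrow> complex^'n^'n" where
  "harm_mean v A B = matrix_inv (v *\<^sub>R matrix_inv A + (1 - v) *\<^sub>R matrix_inv B)"

end

theory Submission
  imports Defs
begin

text \<open>With \<open>D = B - A\<close> and \<open>C = (1 - v) A + v B\<close>, the harmonic mean is \<open>A C\<^sup>-\<^sup>1 B\<close>, and substituting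
  \<open>A = C - v D\<close>, \<open>B = C + (1 - v) D\<close> shows that the difference of the means is \<open>v (1 - v) D C\<^sup>-\<^sup>1 D\<close>.
  Since \<open>C \<ge> m I\<close> and \<open>0 \<le> D \<le> (M - m) I\<close>, we get
  \<open>D C\<^sup>-\<^sup>1 D \<le> m\<^sup>-\<^sup>1 D\<^sup>2 \<le> m\<^sup>-\<^sup>1 (M - m)\<^sup>2 I \<le> (M / m - 1)\<^sup>2 B\<close>.
  Hermitian matrices are handled as self-adjoint operators for the real inner product
  \<open>Re (x\<^sup>* y)\<close> of \<^typ>\<open>complex^'n\<close>.\<close>

lemma Re_quad_form: "Re (quad_form A x) = x \<bullet> (A *v x)"
  by (simp add: quad_form_def inner_vec_def inner_complex_def)

text \<open>A complex factor moved across the real inner product of \<open>complex\<close> becomes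
  its conjugate, and swapping the two sums exchanges rows and columns.\<close>

lemma inner_conj_transpose:
  fixes A :: "complex^'n^'m"
  shows "(A *v x) \<bullet> y = x \<bullet> (map_matrix cnj (transpose A) *v y)"
proof -
  have "(A *v x) \<bullet> y = (\<Sum>i\<in>UNIV. \<Sum>j\<in>UNIV. (A$i$j * x$j) \<bullet> y$i)"
    by (simp add: inner_vec_def matrix_vector_mult_def inner_sum_left)
  also have "\<dots> = (\<Sum>j\<in>UNIV. \<Sum>i\<in>UNIV. (A$i$j * x$j) \<bullet> y$i)"
    by (rule sum.swap)
  also have "\<dots> = (\<Sum>j\<in>UNIV. \<Sum>i\<in>UNIV. x$j \<bullet> (cnj (A$i$j) * y$i))"
    by (intro sum.cong refl) (simp add: inner_complex_def algebra_simps)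
  also have "\<dots> = x \<bullet> (map_matrix cnj (transpose A) *v y)"
    by (simp add: inner_vec_def matrix_vector_mult_def inner_sum_right transpose_def)
  finally show ?thesis .
qed

text \<open>The real inner product is nondegenerate, so adjoints for it are unique: the real parts
  alone already determine the conjugate transpose.\<close>

lemma hermitian_iff_self_adjoint:
  "hermitian A \<longleftrightarrow> (\<forall>x y. (A *v x) \<bullet> y = x \<bullet> (A *v y))"
proof
  show "hermitian A \<Longrightarrow> \<forall>x y. (A *v x) \<bullet> y = x \<bullet> (A *v y)"
    by (metis hermitian_def inner_conj_transpose)
next
  assume "\<forall>x y. (A *v x) \<bullet> y = x \<bullet> (A *v y)"
  then have "x \<bullet> (map_matrix cnj (transpose A) *v y) = x \<bullet> (A *v y)" for x y
    by (metis inner_conj_transpose)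
  then have "map_matrix cnj (transpose A) *v y = A *v y" for y
    by (metis vector_eq_ldot)
  then show "hermitian A"
    by (simp add: hermitian_def matrix_eq)
qed

lemma scaleR_matrix_vector_mult:
  fixes A :: "complex^'n^'m"
  shows "(c *\<^sub>R A) *v x = c *\<^sub>R (A *v x)"
  by (simp add: vec_eq_iff matrix_vector_mult_def scaleR_sum_right)

lemma matrix_vector_mult_scaleR_right:
  fixes A :: "complex^'n^'m"
  shows "A *v (c *\<^sub>R x) = c *\<^sub>R (A *v x)"
  by (simp add: vec_eq_iff matrix_vector_mult_def scaleR_sum_right)

lemma loewner_leD: "S \<le>\<^sub>L T \<Longrightarrow> x \<bullet> (S *v x) \<le> x \<bullet> (T *v x)"
  unfolding loewner_le_def positive_semidefinite_def Re_quad_form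
  by (simp add: matrix_vector_mult_diff_rdistrib inner_diff_right)

lemma loewner_leI:
  assumes "hermitian S" and "hermitian T" and "\<And>x. x \<bullet> (S *v x) \<le> x \<bullet> (T *v x)"
  shows "S \<le>\<^sub>L T"
  using assms unfolding loewner_le_def positive_semidefinite_def Re_quad_form
  by (simp add: hermitian_iff_self_adjoint matrix_vector_mult_diff_rdistrib inner_diff_right
      inner_diff_left)

lemma invertible_if_positive:
  fixes C :: "complex^'n^'n"
  assumes "\<And>x. x \<noteq> 0 \<Longrightarrow> 0 < x \<bullet> (C *v x)"
  shows "invertible C"
  unfolding invertible_left_inverse matrix_left_invertible_ker
  using assms by force

text \<open>This passes from \<open>0 <= D <= k I\<close> to \<open>D^2 <= k^2 I\<close> without
  spectral theory. Positivity of \<open>D\<close> at \<open>k x - D x\<close> says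
  \<open>0 <= k^2 D - 2 k D^2 + D^3\<close>. The upper bound, used at \<open>x\<close> and at
  \<open>D x\<close>, leaves \<open>k D^2 <= k^3 I\<close>.\<close>

lemma norm_square_le_of_bounded_above:
  fixes D :: "complex^'n^'n"
  assumes herm: "hermitian D" and pos: "\<And>x. 0 \<le> x \<bullet> (D *v x)"
    and le: "\<And>x. x \<bullet> (D *v x) \<le> k * (x \<bullet> x)" and k: "0 \<le> k"
  shows "(D *v x) \<bullet> (D *v x) \<le> k\<^sup>2 * (x \<bullet> x)"
proof -
  define y where "y = D *v x"
  have sym: "x \<bullet> (D *v y) = y \<bullet> y"
    using herm by (metis hermitian_iff_self_adjoint y_def)
  have "0 \<le> (k *\<^sub>R x - y) \<bullet> (D *v (k *\<^sub>R x - y))"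
    by (rule pos)
  also have "\<dots> = k\<^sup>2 * (x \<bullet> y) - 2 * k * (y \<bullet> y) + y \<bullet> (D *v y)"
    using sym by (simp add: matrix_vector_mult_diff_distrib matrix_vector_mult_scaleR_right
        flip: y_def) (simp add: inner_diff_left inner_diff_right power2_eq_square algebra_simps)
  also have "\<dots> \<le> k\<^sup>2 * (k * (x \<bullet> x)) - k * (y \<bullet> y)"
    using mult_left_mono[OF le[of x], of "k\<^sup>2"] le[of y] by (simp add: y_def)
  finally have *: "k * (y \<bullet> y) \<le> k * (k\<^sup>2 * (x \<bullet> x))"
    by (simp add: algebra_simps)
  show ?thesis
  \<comment> \<open>For \<open>k = 0\<close> nothing can be cancelled. The test vector
    \<open>x - D x\<close> then forces \<open>D x = 0\<close>, since the bound makes both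
    \<open>x . D x\<close> and \<open>y . D y\<close> nonpositive.\<close>
  proof (cases "k = 0")
    case True
    have "0 \<le> (x - y) \<bullet> (D *v (x - y))"
      by (rule pos)
    also have "\<dots> = x \<bullet> y - 2 * (y \<bullet> y) + y \<bullet> (D *v y)"
      using sym by (simp add: matrix_vector_mult_diff_distrib inner_diff_left inner_diff_right
          flip: y_def)
    finally show ?thesis
      using True le[of x] le[of y] by (simp add: y_def)
  next
    case False
    with * k show ?thesis
      by (simp add: y_def)
  qed
qed

text \<open>Expand \<open>|C z - m z|^2 >= 0\<close> and bound \<open>m^2 |z|^2\<close> by
  \<open>m (z . C z)\<close>. For \<open>m > 0\<close> and \<open>C z = w\<close> it serves as the
  estimate \<open>C^-1 <= m^-1 I\<close> at \<open>w\<close>.\<close>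

lemma inner_le_norm_square_of_bounded_below:
  fixes C :: "complex^'n^'n"
  assumes "m * (z \<bullet> z) \<le> z \<bullet> (C *v z)" and "0 \<le> m"
  shows "m * (z \<bullet> (C *v z)) \<le> (C *v z) \<bullet> (C *v z)"
proof -
  have "0 \<le> (C *v z - m *\<^sub>R z) \<bullet> (C *v z - m *\<^sub>R z)"
    by simp
  also have "\<dots> = (C *v z) \<bullet> (C *v z) - 2 * m * (z \<bullet> (C *v z)) + m * (m * (z \<bullet> z))"
    by (simp add: inner_diff_left inner_diff_right inner_commute algebra_simps)
  finally show ?thesis
    using mult_left_mono[OF assms] by simp
qed

lemma matrix_inv_eqI:
  fixes A B :: "'a::semiring_1^'n^'n"
  assumes "A ** B = mat 1" and "B ** A = mat 1"
  shows "matrix_inv A = B"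
  unfolding matrix_inv_def
proof (rule some_equality)
  fix A' assume "A ** A' = mat 1 \<and> A' ** A = mat 1"
  then show "A' = B"
    by (metis assms(1) matrix_mul_assoc matrix_mul_lid matrix_mul_rid)
qed (use assms in simp)

lemma matrix_inv_vec:
  fixes A :: "'a::comm_semiring_1^'n^'n"
  assumes "invertible A"
  shows "A *v (matrix_inv A *v x) = x" "matrix_inv A *v (A *v x) = x"
proof -
  obtain B where "A ** B = mat 1" "B ** A = mat 1"
    using assms invertible_def by blast
  moreover from this have "matrix_inv A = B"
    by (rule matrix_inv_eqI)
  ultimately show "A *v (matrix_inv A *v x) = x" "matrix_inv A *v (A *v x) = x"
    by (simp_all add: matrix_vector_mul_assoc)
qed

text \<open>Factoring \<open>B^-1\<close> out on the left and \<open>A^-1\<close> on the right gives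
  \<open>v A^-1 + (1 - v) B^-1 = B^-1 ((1 - v) A + v B) A^-1\<close>. The weights trade places
  because \<open>v A^-1 = B^-1 (v B) A^-1\<close>.\<close>

lemma harm_mean_eq:
  fixes A B :: "complex^'n^'n"
  assumes A: "invertible A" and B: "invertible B" and C: "invertible ((1 - v) *\<^sub>R A + v *\<^sub>R B)"
  shows "harm_mean v A B = A ** matrix_inv ((1 - v) *\<^sub>R A + v *\<^sub>R B) ** B"
proof -
  define C where "C = (1 - v) *\<^sub>R A + v *\<^sub>R B"
  define H where "H = v *\<^sub>R matrix_inv A + (1 - v) *\<^sub>R matrix_inv B"
  have H: "H = matrix_inv B ** C ** matrix_inv A"
    unfolding matrix_eq
    by (simp add: H_def C_def matrix_vector_mult_add_rdistrib scaleR_matrix_vector_mult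
        matrix_vector_mult_scaleR_right matrix_vector_right_distrib matrix_inv_vec A B
        flip: matrix_vector_mul_assoc)
  have "H ** (A ** matrix_inv C ** B) = mat 1" "(A ** matrix_inv C ** B) ** H = mat 1"
    using C unfolding matrix_eq H
    by (simp_all add: matrix_inv_vec A B flip: matrix_vector_mul_assoc C_def)
  then show ?thesis
    unfolding harm_mean_def C_def[symmetric] H_def[symmetric] by (rule matrix_inv_eqI)
qed

theorem theorem3p4:
  fixes A B :: "complex^'n^'n" and m M v :: real
  assumes "positive_definite A" and "positive_definite B"
    and "positive_definite (m *\<^sub>R mat 1 :: complex^'n^'n)"
    and "m *\<^sub>R mat 1 \<le>\<^sub>L A" and "A \<le>\<^sub>L B" and "B \<le>\<^sub>L M *\<^sub>R mat 1"
    and "0 \<le> v" and "v \<le> 1"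
  shows "arith_mean v A B - harm_mean v A B \<le>\<^sub>L (v * (1 - v) * (1 - M / m)\<^sup>2) *\<^sub>R B"
proof -
  note vec_simps = matrix_vector_mult_add_rdistrib matrix_vector_mult_diff_rdistrib
    scaleR_matrix_vector_mult matrix_vector_mult_scaleR_right matrix_vector_right_distrib
    matrix_vector_mult_diff_distrib
  define C where "C = (1 - v) *\<^sub>R A + v *\<^sub>R B"
  define D where "D = B - A"
  have herm: "hermitian A" "hermitian B"
    and pos: "\<And>x. x \<noteq> 0 \<Longrightarrow> 0 < x \<bullet> (A *v x)" "\<And>x. x \<noteq> 0 \<Longrightarrow> 0 < x \<bullet> (B *v x)"
    using assms(1,2) by (auto simp: positive_definite_def Re_quad_form)
  have mA: "m * (x \<bullet> x) \<le> x \<bullet> (A *v x)" for x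
    using loewner_leD[OF assms(4)] by (simp add: vec_simps)
  have AB: "x \<bullet> (A *v x) \<le> x \<bullet> (B *v x)" for x
    using loewner_leD[OF assms(5)] .
  have BM: "x \<bullet> (B *v x) \<le> M * (x \<bullet> x)" for x
    using loewner_leD[OF assms(6)] by (simp add: vec_simps)
  \<comment> \<open>Testing the matrix hypotheses on a single nonzero vector yields the scalar facts
    \<open>0 < m\<close> and \<open>m <= M\<close>.\<close>
  obtain e :: "complex^'n" where e: "e \<noteq> 0"
    by (metis zero_neq_one)
  then have "0 < m * (e \<bullet> e)"
    using assms(3) by (auto simp: positive_definite_def Re_quad_form vec_simps)
  then have m: "0 < m"
    by (metis inner_ge_zero zero_less_mult_pos2 order_less_le mult_not_zero)
  have "m * (e \<bullet> e) \<le> M * (e \<bullet> e)"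
    by (rule order_trans[OF mA order_trans[OF AB BM]])
  then have mM: "m \<le> M"
    using e by simp
  have mC: "m * (x \<bullet> x) \<le> x \<bullet> (C *v x)" for x
  proof -
    have "m * (x \<bullet> x) = (1 - v) * (m * (x \<bullet> x)) + v * (m * (x \<bullet> x))"
      by (simp add: algebra_simps)
    also have "\<dots> \<le> (1 - v) * (x \<bullet> (A *v x)) + v * (x \<bullet> (B *v x))"
      using assms(7,8) mA AB by (intro add_mono mult_left_mono order_trans[OF mA AB]) auto
    finally show ?thesis
      by (simp add: C_def vec_simps inner_add_right)
  qed
  have inv: "invertible A" "invertible B" "invertible C"
    using pos mC m by (auto intro!: invertible_if_positive less_le_trans[OF _ mC])
  have hermD: "hermitian D" and hermC: "hermitian C"
    using herm by (simp_all add: hermitian_iff_self_adjoint C_def D_def vec_simps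
        inner_diff_left inner_diff_right inner_add_left inner_add_right)
  have hermCi: "hermitian (matrix_inv C)"
    unfolding hermitian_iff_self_adjoint
    by (metis hermC hermitian_iff_self_adjoint inv(3) matrix_inv_vec(1))
  have AC: "A = C - v *\<^sub>R D" and BC: "B = C + (1 - v) *\<^sub>R D"
    by (simp_all add: C_def D_def vec_eq_iff algebra_simps)
  have "harm_mean v A B = A ** matrix_inv C ** B"
    using harm_mean_eq inv unfolding C_def by blast
  also have "\<dots> = (C - v *\<^sub>R D) ** matrix_inv C ** (C + (1 - v) *\<^sub>R D)"
    by (simp flip: AC BC)
  finally have harm: "harm_mean v A B = \<dots>" .
  have "arith_mean v A B = C + (1 - 2 * v) *\<^sub>R D"
    by (simp add: arith_mean_def C_def D_def vec_eq_iff scaleR_conv_of_real algebra_simps)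
  \<comment> \<open>The product in \<open>harm\<close> expands to
    \<open>C + (1 - 2 v) D - v (1 - v) D C^-1 D\<close>, whose first two terms are the arithmetic
    mean.\<close>
  then have diff: "arith_mean v A B - harm_mean v A B
      = (v * (1 - v)) *\<^sub>R (D ** matrix_inv C ** D)"
    unfolding matrix_eq
    by (simp add: harm vec_simps matrix_inv_vec inv flip: matrix_vector_mul_assoc)
      (simp add: vec_eq_iff scaleR_conv_of_real algebra_simps)
  show ?thesis
    unfolding diff
  proof (rule loewner_leI)
    show "hermitian ((v * (1 - v)) *\<^sub>R (D ** matrix_inv C ** D))"
      using hermD hermCi
      by (simp add: hermitian_iff_self_adjoint vec_simps flip: matrix_vector_mul_assoc)
    show "hermitian ((v * (1 - v) * (1 - M / m)\<^sup>2) *\<^sub>R B)"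
      using herm by (simp add: hermitian_iff_self_adjoint vec_simps)
  next
    fix x
    \<comment> \<open>With this \<open>z\<close>, the form of \<open>D C^-1 D\<close> at
      \<open>x\<close> is \<open>x . D z = z . C z\<close>, so the estimates involve only
      \<open>C\<close> and \<open>D\<close>.\<close>
    define z where "z = matrix_inv C *v (D *v x)"
    have Cz: "C *v z = D *v x"
      by (simp add: z_def matrix_inv_vec inv)
    have "m * (x \<bullet> (D *v z)) = m * (z \<bullet> (C *v z))"
      by (metis Cz hermD hermitian_iff_self_adjoint inner_commute)
    also have "\<dots> \<le> (D *v x) \<bullet> (D *v x)"
      using inner_le_norm_square_of_bounded_below[OF mC, of z] m by (simp add: Cz)
    also have "\<dots> \<le> (M - m)\<^sup>2 * (x \<bullet> x)"
    proof (rule norm_square_le_of_bounded_above[OF hermD])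
      show "0 \<le> y \<bullet> (D *v y)" "y \<bullet> (D *v y) \<le> (M - m) * (y \<bullet> y)" for y
        using mA[of y] AB[of y] BM[of y]
        by (simp_all add: D_def vec_simps inner_diff_right algebra_simps)
    qed (use mM in simp)
    \<comment> \<open>The second factor \<open>m\<close> lets \<open>m (x . x) <= x . B x\<close>
      bring in \<open>B\<close>; the resulting \<open>m^2\<close> on the left is absorbed by
      \<open>(M - m)^2 = m^2 (1 - M/m)^2\<close>.\<close>
    finally have "m * (m * (x \<bullet> (D *v z))) \<le> m * ((M - m)\<^sup>2 * (x \<bullet> x))"
      using m by simp
    also have "\<dots> \<le> (M - m)\<^sup>2 * (x \<bullet> (B *v x))"
      using mult_left_mono[OF order_trans[OF mA AB], of "(M - m)\<^sup>2" x] by (simp add: algebra_simps)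
    also have "(M - m)\<^sup>2 = m * (m * (1 - M / m)\<^sup>2)"
      using m by (simp add: power2_eq_square field_simps)
    finally have "x \<bullet> (D *v z) \<le> (1 - M / m)\<^sup>2 * (x \<bullet> (B *v x))"
      using m by (simp add: mult.assoc)
    then have "v * (1 - v) * (x \<bullet> (D *v z)) \<le> v * (1 - v) * ((1 - M / m)\<^sup>2 * (x \<bullet> (B *v x)))"
      using assms(7,8) by (intro mult_left_mono) auto
    then show "x \<bullet> (((v * (1 - v)) *\<^sub>R (D ** matrix_inv C ** D)) *v x)
        \<le> x \<bullet> (((v * (1 - v) * (1 - M / m)\<^sup>2) *\<^sub>R B) *v x)"
      by (simp add: z_def vec_simps mult.assoc flip: matrix_vector_mul_assoc)
  qed
qed

end
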